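(* For every $n\ge1$, in $\mathbf{sNSym}$, $$(n+1)\tilde P_n=-R_{(\dot0,n)}+(-1)^nR_{(1^n,\dot0)}+\sum_{k=1}^{n-1}(-1)^{k+1}\left(\sum_{i=1}^kR_{(1^{i-1},\dot1,1^{k-i},n-k)}+\sum_{i=0}^kR_{(1^i,\dot0,1^{k-i},n-k)}\right),$$ where $1^j$ stands for $j$ consecutive entries equal to $1$.
   Context: Let $\mathbb N=\{1,2,\ldots\}$ and $\dot{\mathbb N}_0=\{\dot0,\dot1,\dot2,\ldots\}$ (dotted copies of the nonnegative integers). A dotted composition is a finite tuple $\alpha=(\alpha_1,\ldots,\alpha_k)$ with entries in $\mathbb N\cup\dot{\mathbb N}_0$. For entries not both dotted put $m\oplus n=m+n$ and $m\oplus\dot n=\dot m\oplus n=\dot r$ with $r=m+n$. The partial order $\preceq$ on dotted compositions is the reflexive-transitive closure of the relation: $\beta$ is obtained from $\alpha$ by replacing two consecutive entries $x,y$ of $\alpha$ that are not both dotted by the single entry $x\oplus y$ (then $\alpha\preceq\beta$). $\mathbf{sNSym}$, as an algebra, is the free associative unital $\mathbb Q$-algebra on generators $H_n$ ($n\in\mathbb N$) and $H_{\dot n}=\tilde H_n$ ($n\ge0$), with $H_0=1$; $H_\alpha:=H_{\alpha_1}\cdots H_{\alpha_k}$. The noncommutative Ribbon Schur functions in superspace $R_\alpha$ are defined recursively by $R_\alpha=H_\alpha-\sum_{\alpha\prec\beta}R_\beta$. The noncommutative power sums in superspace $P_n,\tilde P_n$ are defined by the generating function identity $\lambda(t,\tau)\Pi(t,\tau)=(t\partial_t+\tau\partial_\tau)\lambda(t,\tau)$,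 where $\lambda(t,\tau)=\sum_{n\ge0}t^n(H_n+\tau\tilde H_n)$ and $\Pi(t,\tau)=\sum_{n\ge0}t^n(P_n+\tau(n+1)\tilde P_n)$, $\tau^2=0$. Explicitly: $P_0=0$, $\sum_{k=0}^{n-1}H_kP_{n-k}=nH_n$ for $n\ge1$, and $\sum_{k=0}^n\left(\tilde H_{n-k}P_k+(k+1)H_{n-k}\tilde P_k\right)=(n+1)\tilde H_n$ for $n\ge0$. *)

theory Defs
  imports Complex_Main "HOL-Library.Poly_Mapping"
begin

section \<open>Dotted compositions\<close>

text \<open>
  \<open>UndottedSuc m\<close> is the undotted entry \<open>m + 1\<close>, so that the undotted entries are exactly the
  positive integers; \<open>Dotted m\<close> is the dotted entry \<open>m\<close>, with \<open>m = 0\<close> allowed.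
\<close>

datatype entry = UndottedSuc nat | Dotted nat

text \<open>Only meaningful for \<open>n \<ge> 1\<close>: the undotted entry \<open>n\<close>.\<close>

definition undotted :: "nat \<Rightarrow> entry"
  where "undotted n = UndottedSuc (n - 1)"

fun is_dotted :: "entry \<Rightarrow> bool" where
  "is_dotted (UndottedSuc m) = False"
| "is_dotted (Dotted m) = True"

fun entry_value :: "entry \<Rightarrow> nat" where
  "entry_value (UndottedSuc m) = m + 1"
| "entry_value (Dotted m) = m"

text \<open>Only used for entries that are not both dotted.\<close>

definition entry_add :: "entry \<Rightarrow> entry \<Rightarrow> entry"  (infixl "\<oplus>" 65)
  where "x \<oplus> y =
    (if is_dotted x \<or> is_dotted y then Dotted (entry_value x + entry_value y)
     else undotted (entry_value x + entry_value y))"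

type_synonym dotted_composition = "entry list"

inductive merge_step :: "dotted_composition \<Rightarrow> dotted_composition \<Rightarrow> bool" where
  "\<not> (is_dotted x \<and> is_dotted y) \<Longrightarrow> merge_step (us @ [x, y] @ vs) (us @ [x \<oplus> y] @ vs)"

definition comp_le :: "dotted_composition \<Rightarrow> dotted_composition \<Rightarrow> bool"  (infix "\<preceq>" 50)
  where "\<alpha> \<preceq> \<beta> \<longleftrightarrow> merge_step\<^sup>*\<^sup>* \<alpha> \<beta>"

definition comp_less :: "dotted_composition \<Rightarrow> dotted_composition \<Rightarrow> bool"  (infix "\<prec>" 50)
  where "\<alpha> \<prec> \<beta> \<longleftrightarrow> \<alpha> \<preceq> \<beta> \<and> \<alpha> \<noteq> \<beta>"

lemma merge_step_length: "merge_step \<alpha> \<beta> \<Longrightarrow> length \<alpha> = Suc (length \<beta>)"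
  by (induction rule: merge_step.induct) simp

lemma comp_le_length: "\<alpha> \<preceq> \<beta> \<Longrightarrow> \<alpha> = \<beta> \<or> length \<beta> < length \<alpha>"
  unfolding comp_le_def
  by (induction rule: rtranclp_induct) (auto dest: merge_step_length)

lemma comp_less_length: "\<alpha> \<prec> \<beta> \<Longrightarrow> length \<beta> < length \<alpha>"
  using comp_le_length by (auto simp: comp_less_def)

lemma comp_le_antisym: "\<alpha> \<preceq> \<beta> \<Longrightarrow> \<beta> \<preceq> \<alpha> \<Longrightarrow> \<alpha> = \<beta>"
  using comp_le_length[of \<alpha> \<beta>] comp_le_length[of \<beta> \<alpha>] by auto

lemma finite_merge_step: "finite {\<beta>. merge_step \<alpha> \<beta>}"
proof -
  let ?f = "\<lambda>i. take i \<alpha> @ [\<alpha> ! i \<oplus> \<alpha> ! Suc i] @ drop (Suc (Suc i)) \<alpha>"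
  have "{\<beta>. merge_step \<alpha> \<beta>} \<subseteq> ?f ` {..<length \<alpha>}"
  proof
    fix \<beta> assume "\<beta> \<in> {\<beta>. merge_step \<alpha> \<beta>}"
    then have "merge_step \<alpha> \<beta>" by simp
    then obtain x y us vs where
      "\<alpha> = us @ [x, y] @ vs" "\<beta> = us @ [x \<oplus> y] @ vs"
      by (rule merge_step.cases)
    then have "\<beta> = ?f (length us)" "length us < length \<alpha>"
      by (auto simp: nth_append)
    then show "\<beta> \<in> ?f ` {..<length \<alpha>}" by blast
  qed
  then show ?thesis by (rule finite_subset) simp
qed

text \<open>The sum in the recursion for the ribbon functions is a finite one.\<close>

lemma finite_comp_le: "finite {\<beta>. \<alpha> \<preceq> \<beta>}"
proof (induction "length \<alpha>" arbitrary: \<alpha> rule: less_induct)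
  case less
  have "{\<beta>. \<alpha> \<preceq> \<beta>} \<subseteq> insert \<alpha> (\<Union>\<gamma>\<in>{\<gamma>. merge_step \<alpha> \<gamma>}. {\<beta>. \<gamma> \<preceq> \<beta>})"
  proof
    fix \<beta> assume "\<beta> \<in> {\<beta>. \<alpha> \<preceq> \<beta>}"
    then have "merge_step\<^sup>*\<^sup>* \<alpha> \<beta>" by (simp add: comp_le_def)
    then show "\<beta> \<in> insert \<alpha> (\<Union>\<gamma>\<in>{\<gamma>. merge_step \<alpha> \<gamma>}. {\<beta>. \<gamma> \<preceq> \<beta>})"
      by (cases rule: converse_rtranclpE) (simp_all add: comp_le_def, blast)
  qed
  then show ?case
  proof (rule finite_subset)
    have fin: "finite {\<beta>. \<gamma> \<preceq> \<beta>}" if "merge_step \<alpha> \<gamma>" for \<gamma>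
      using less merge_step_length[OF that] by simp
    show "finite (insert \<alpha> (\<Union>\<gamma>\<in>{\<gamma>. merge_step \<alpha> \<gamma>}. {\<beta>. \<gamma> \<preceq> \<beta>}))"
      by (intro finite.insertI finite_UN_I finite_merge_step) (simp add: fin)
  qed
qed

lemma finite_comp_less: "finite {\<beta>. \<alpha> \<prec> \<beta>}"
  by (rule finite_subset[OF _ finite_comp_le[of \<alpha>]]) (auto simp: comp_less_def)

section \<open>The algebra sNSym\<close>

text \<open>
  Lists under concatenation are the free monoid; with this instance, finitely supported functions
  from words to the rationals, under convolution, are the free associative unital algebra.
\<close>

instantiation list :: (type) monoid_add
begin
definition zero_list :: "'a list" where "zero_list = []"
definition plus_list :: "'a list \<Rightarrow> 'a list \<Rightarrow> 'a list" where "plus_list xs ys = xs @ ys"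
instance by standard (simp_all add: zero_list_def plus_list_def)
end

text \<open>The letters are the generators: \<open>UndottedSuc m\<close> for \<open>H\<^sub>m\<^sub>+\<^sub>1\<close>, \<open>Dotted m\<close> for \<open>H\<close> with index dotted \<open>m\<close>.\<close>

type_synonym sNSym = "entry list \<Rightarrow>\<^sub>0 rat"

definition scale :: "rat \<Rightarrow> sNSym \<Rightarrow> sNSym"
  where "scale c f = Poly_Mapping.single 0 c * f"

definition generator :: "entry \<Rightarrow> sNSym"
  where "generator x = Poly_Mapping.single [x] 1"

definition H :: "nat \<Rightarrow> sNSym"
  where "H n = (if n = 0 then 1 else generator (undotted n))"

definition Ht :: "nat \<Rightarrow> sNSym"
  where "Ht n = generator (Dotted n)"

definition Hcomp :: "dotted_composition \<Rightarrow> sNSym"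
  where "Hcomp \<alpha> = prod_list (map generator \<alpha>)"

section \<open>Ribbon Schur functions\<close>

function R :: "dotted_composition \<Rightarrow> sNSym" where
  "R \<alpha> = Hcomp \<alpha> - (\<Sum>\<beta> | \<alpha> \<prec> \<beta>. R \<beta>)"
  by auto
termination
  by (relation "measure length") (auto dest: comp_less_length)

declare R.simps [simp del]

section \<open>Power sums\<close>

text \<open>
  The coefficients of \<open>t\<^sup>n\<close> and \<open>\<tau> t\<^sup>n\<close> in
  \<open>\<lambda>(t,\<tau>) \<Pi>(t,\<tau>) = (t \<partial>\<^sub>t + \<tau> \<partial>\<^sub>\<tau>) \<lambda>(t,\<tau>)\<close> are the identities \<open>H_P\<close> and \<open>Ht_P_H_Pt\<close> below;
  since \<open>H 0 = 1\<close>, they can be solved recursively for \<open>P n\<close> and \<open>Pt n\<close>.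
\<close>

fun P :: "nat \<Rightarrow> sNSym" where
  "P n = of_nat n * H n - (\<Sum>k\<in>{1..<n}. H k * P (n - k))"

declare P.simps [simp del]

fun Pt :: "nat \<Rightarrow> sNSym" where
  "Pt n = scale (1 / of_nat (n + 1))
     (of_nat (n + 1) * Ht n - (\<Sum>k\<le>n. Ht (n - k) * P k)
      - (\<Sum>k<n. of_nat (k + 1) * (H (n - k) * Pt k)))"

declare Pt.simps [simp del]

lemma of_nat_times_scale: "of_nat (n + 1) * scale (1 / of_nat (n + 1)) f = f"
proof -
  have "Poly_Mapping.single 0 (of_nat (n + 1)) * Poly_Mapping.single 0 (1 / of_nat (n + 1))
      = (1 :: sNSym)"
    by (simp add: Poly_Mapping.mult_single del: single_of_nat of_nat_Suc of_nat_add)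
  then show ?thesis
    by (simp only: scale_def mult.assoc[symmetric] single_of_nat mult_1_left)
qed

lemma P_0: "P 0 = 0"
  by (subst P.simps) simp

lemma H_P:
  assumes "n \<ge> 1"
  shows "(\<Sum>k<n. H k * P (n - k)) = of_nat n * H n"
proof -
  have "{..<n} = insert 0 {1..<n}"
    using assms by auto
  then have "(\<Sum>k<n. H k * P (n - k)) = P n + (\<Sum>k\<in>{1..<n}. H k * P (n - k))"
    by (simp add: H_def[of 0])
  then show ?thesis
    by (subst (asm) P.simps[of n]) simp
qed

lemma Ht_P_H_Pt:
  "(\<Sum>k\<le>n. Ht (n - k) * P k + of_nat (k + 1) * (H (n - k) * Pt k)) = of_nat (n + 1) * Ht n"
proof -
  have "(\<Sum>k\<le>n. of_nat (k + 1) * (H (n - k) * Pt k))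
      = (\<Sum>k<n. of_nat (k + 1) * (H (n - k) * Pt k)) + of_nat (n + 1) * Pt n"
    by (simp add: lessThan_Suc_atMost[symmetric] H_def[of 0])
  moreover have "of_nat (n + 1) * Pt n
      = of_nat (n + 1) * Ht n - (\<Sum>k\<le>n. Ht (n - k) * P k)
        - (\<Sum>k<n. of_nat (k + 1) * (H (n - k) * Pt k))"
    by (subst Pt.simps) (rule of_nat_times_scale)
  ultimately show ?thesis
    by (simp add: sum.distrib del: of_nat_Suc of_nat_add)
qed

end

theory Submission
  imports Defs "HOL-Computational_Algebra.Formal_Power_Series"
begin

text \<open>
  Write \<open>\<lambda> = h + \<tau> h'\<close> for the generating function of the generators, with \<open>\<tau>\<close> central and
  \<open>\<tau>\<^sup>2 = 0\<close>.  The power sums are the coefficients of \<open>\<lambda>\<^sup>-\<^sup>1 (t \<partial>\<^sub>t + \<tau> \<partial>\<^sub>\<tau>) \<lambda>\<close>, and the formula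
  comes from writing \<open>\<lambda>\<^sup>-\<^sup>1\<close> in ribbons, multiplying out and telescoping.

  Everything rests on one product rule (\<open>R_mult_generator\<close>): multiplying a ribbon \<open>R\<^sub>\<alpha>\<close> on the right
  by a generator with index \<open>y\<close>, where \<open>\<alpha>\<close> is nonempty and \<open>y\<close> is undotted or \<open>\<alpha>\<close> has no dots,
  gives two ribbons, in which \<open>y\<close> is appended to \<open>\<alpha>\<close> or added to the last entry of \<open>\<alpha>\<close>.  It reflects the fact that a coarsening of \<open>\<alpha>\<close> followed by \<open>y\<close> is a coarsening
  of \<open>\<alpha>\<close> to which \<open>y\<close> has been attached in one of these ways.

  Let \<open>E\<^sub>k\<close> be the ribbon of the column \<open>1\<^sup>k\<close>, and let \<open>D\<^sub>k\<close> be the sum of the ribbons obtained from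
  \<open>1\<^sup>k\<close> by putting a dot on one of its entries or by inserting a dotted \<open>0\<close>.  Let \<open>D\<^sub>k\<^sub>,\<^sub>m\<close> be the
  same sum with a further entry \<open>m\<close> at the end of every composition, and \<open>0\<close> if \<open>m = 0\<close> or \<open>k = -1\<close>.
  The product rule gives
  \<open>D\<^sub>k H\<^sub>m = D\<^sub>k\<^sub>,\<^sub>m + D\<^sub>k\<^sub>-\<^sub>1\<^sub>,\<^sub>m\<^sub>+\<^sub>1 + E\<^sub>k H'\<^sub>m\<close>, where \<open>H'\<^sub>m\<close> is the generator
  with the dotted index \<open>m\<close> (\<open>dotted_ones_mult_H\<close>).
  With alternating signs these relations telescope, and say that
  \<open>\<lambda>\<^sup>-\<^sup>1 = \<Sum>\<^sub>k (-t)\<^sup>k (E\<^sub>k - \<tau> D\<^sub>k)\<close> (\<open>inv_even_mult_H\<close>, \<open>inv_odd_mult_H\<close>).  Hence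
  \<open>(n + 1) P'\<^sub>n = \<Sum>\<^sub>k (-1)\<^sup>k ((n - k + 1) E\<^sub>k H'\<^sub>n\<^sub>-\<^sub>k - (n - k) D\<^sub>k H\<^sub>n\<^sub>-\<^sub>k)\<close>, where \<open>P'\<^sub>n\<close> is the dotted
  power sum (\<open>odd_power_sum_series\<close>).  By the relation for \<open>D\<^sub>k H\<^sub>m\<close>, what remains of the terms
  \<open>E\<^sub>k H'\<^sub>n\<^sub>-\<^sub>k\<close> has coefficient \<open>(-1)\<^sup>k\<close>, and telescopes to the ribbon of \<open>1\<^sup>n\<close> followed
  by a dotted \<open>0\<close>.  The terms \<open>D\<^sub>k\<^sub>,\<^sub>n\<^sub>-\<^sub>k\<close> occur with the weights \<open>n - k\<close> and \<open>n - k - 1\<close> and opposite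
  signs, so each of them survives exactly once.
\<close>

section \<open>Coarsenings of a composition with one more entry\<close>

text \<open>The entry written \<open>undotted 1\<close> should not be rewritten to \<open>undotted (Suc 0)\<close>.\<close>

declare One_nat_def [simp del]

lemma is_dotted_undotted [simp]: "\<not> is_dotted (undotted n)"
  by (simp add: undotted_def)

lemma entry_value_undotted [simp]: "n \<ge> 1 \<Longrightarrow> entry_value (undotted n) = n"
  by (simp add: undotted_def)

lemma is_dotted_entry_add [simp]: "is_dotted (x \<oplus> y) \<longleftrightarrow> is_dotted x \<or> is_dotted y"
  by (simp add: entry_add_def)

lemma entry_value_pos: "\<not> is_dotted x \<Longrightarrow> entry_value x \<ge> 1"
  by (cases x) auto

lemma entry_value_entry_add [simp]: "entry_value (x \<oplus> y) = entry_value x + entry_value y"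
  using entry_value_pos[of x] by (auto simp: entry_add_def)

lemma entry_eq_iff: "x = y \<longleftrightarrow> is_dotted x = is_dotted y \<and> entry_value x = entry_value y"
  by (cases x; cases y) auto

lemma entry_add_assoc: "x \<oplus> y \<oplus> z = x \<oplus> (y \<oplus> z)"
  by (simp add: entry_eq_iff)

text \<open>
  The condition under which \<open>y\<close> may be merged into any coarsening of \<open>\<alpha>\<close>.  It constrains all entries,
  not only the last one, because a dot anywhere in \<open>\<alpha>\<close> can move into the last entry under merging.
\<close>

definition attachable :: "dotted_composition \<Rightarrow> entry \<Rightarrow> bool"
  where "attachable \<alpha> y \<longleftrightarrow> \<alpha> \<noteq> [] \<and> (\<forall>x\<in>set \<alpha>. \<not> (is_dotted x \<and> is_dotted y))"

definition fuse :: "dotted_composition \<Rightarrow> entry \<Rightarrow> dotted_composition"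
  where "fuse \<alpha> y = butlast \<alpha> @ [last \<alpha> \<oplus> y]"

lemma fuse_snoc [simp]: "fuse (us @ [x]) y = us @ [x \<oplus> y]"
  by (simp add: fuse_def)

lemma merge_step_attachable: "merge_step \<alpha> \<beta> \<Longrightarrow> attachable \<alpha> y \<Longrightarrow> attachable \<beta> y"
  by (induction rule: merge_step.induct) (auto simp: attachable_def)

lemma comp_le_attachable: "\<alpha> \<preceq> \<beta> \<Longrightarrow> attachable \<alpha> y \<Longrightarrow> attachable \<beta> y"
  unfolding comp_le_def by (induction rule: rtranclp_induct) (auto intro: merge_step_attachable)

lemma merge_step_snoc: "merge_step \<alpha> \<beta> \<Longrightarrow> merge_step (\<alpha> @ [y]) (\<beta> @ [y])"
proof (induction rule: merge_step.induct)
  case (1 x z us vs)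
  then show ?case using merge_step.intros[of x z us "vs @ [y]"] by simp
qed

lemma merge_step_snoc_cases:
  assumes "merge_step (\<alpha> @ [y]) \<gamma>"
  obtains (before) \<beta> where "merge_step \<alpha> \<beta>" "\<gamma> = \<beta> @ [y]"
  | (last) us x where "\<alpha> = us @ [x]" "\<not> (is_dotted x \<and> is_dotted y)" "\<gamma> = us @ [x \<oplus> y]"
  using assms
proof cases
  case (1 x z us vs)
  show thesis
  proof (cases vs rule: rev_exhaust)
    case Nil
    with 1 show thesis using last[of us x] by simp
  next
    case (snoc vs' v)
    with 1 have "\<alpha> = us @ [x, z] @ vs'" "v = y"
      by (metis append.assoc append1_eq_conv)+
    with 1 snoc show thesis
      using before[of "us @ [x \<oplus> z] @ vs'"] merge_step.intros[of x z us vs'] by simp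
  qed
qed

lemma comp_le_snoc: "\<alpha> \<preceq> \<beta> \<Longrightarrow> \<alpha> @ [y] \<preceq> \<beta> @ [y]"
  unfolding comp_le_def
  by (induction rule: rtranclp_induct) (auto intro: rtranclp.rtrancl_into_rtrancl merge_step_snoc)

lemma merge_step_fuse: "attachable \<beta> y \<Longrightarrow> merge_step (\<beta> @ [y]) (fuse \<beta> y)"
  using merge_step.intros[of "last \<beta>" y "butlast \<beta>" "[]"]
  by (cases \<beta> rule: rev_exhaust) (auto simp: attachable_def)

text \<open>
  By associativity of \<open>\<oplus>\<close>, a merge that swallows the fused entry \<open>x \<oplus> y\<close> can be done before
  \<open>y\<close> is attached; so the coarsenings of the form \<open>fuse \<beta> y\<close> are closed under merging.
\<close>

lemma merge_step_from_fuse: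
  assumes "merge_step (fuse \<beta> y) \<gamma>" "attachable \<beta> y"
  shows "\<exists>\<delta>. merge_step \<beta> \<delta> \<and> \<gamma> = fuse \<delta> y"
proof -
  obtain us x where \<beta>: "\<beta> = us @ [x]"
    using assms(2) by (cases \<beta> rule: rev_exhaust) (auto simp: attachable_def)
  have "merge_step (us @ [x \<oplus> y]) \<gamma>"
    using assms(1) by (simp add: \<beta>)
  then show ?thesis
  proof (cases rule: merge_step_snoc_cases)
    case (before us')
    then show ?thesis using merge_step_snoc[of us us' x] \<beta> by (metis fuse_snoc)
  next
    case (last vs w)
    then have "merge_step \<beta> (vs @ [w \<oplus> x])"
      using merge_step.intros[of w x vs "[]"] \<beta> by simp
    moreover have "\<gamma> = fuse (vs @ [w \<oplus> x]) y"
      using last by (simp add: entry_add_assoc)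
    ultimately show ?thesis by blast
  qed
qed

text \<open>
  In a sequence of merges of \<open>\<alpha> @ [y]\<close>, the entry \<open>y\<close> stays separate until some step fuses it
  with its left neighbour, and all other merges could have been made without it.
\<close>

lemma coarsenings_snoc:
  assumes "attachable \<alpha> y"
  shows "{\<gamma>. \<alpha> @ [y] \<preceq> \<gamma>} = (\<lambda>\<beta>. \<beta> @ [y]) ` {\<beta>. \<alpha> \<preceq> \<beta>} \<union> (\<lambda>\<beta>. fuse \<beta> y) ` {\<beta>. \<alpha> \<preceq> \<beta>}"
    (is "_ = ?S")
proof (intro equalityI subsetI)
  fix \<gamma> assume "\<gamma> \<in> {\<gamma>. \<alpha> @ [y] \<preceq> \<gamma>}"
  then have "merge_step\<^sup>*\<^sup>* (\<alpha> @ [y]) \<gamma>" by (simp add: comp_le_def)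
  then show "\<gamma> \<in> ?S"
  proof (induction rule: rtranclp_induct)
    case base
    then show ?case by (simp add: comp_le_def)
  next
    case (step \<gamma> \<delta>)
    from step.IH consider (sep) \<beta> where "\<alpha> \<preceq> \<beta>" "\<gamma> = \<beta> @ [y]" | (fus) \<beta> where "\<alpha> \<preceq> \<beta>" "\<gamma> = fuse \<beta> y"
      by blast
    then show ?case
    proof cases
      case sep
      with step.hyps have "merge_step (\<beta> @ [y]) \<delta>" by simp
      then show ?thesis
      proof (cases rule: merge_step_snoc_cases)
        case (before \<beta>')
        then have "\<alpha> \<preceq> \<beta>'" using sep by (auto simp: comp_le_def)
        with before show ?thesis by blast
      next
        case (last us x)
        then show ?thesis using sep by (metis (mono_tags, lifting) UnI2 fuse_snoc image_eqI mem_Collect_eq)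
      qed
    next
      case fus
      with step.hyps merge_step_from_fuse[of \<beta> y \<delta>] comp_le_attachable[OF _ assms]
      obtain \<beta>' where "merge_step \<beta> \<beta>'" "\<delta> = fuse \<beta>' y" by blast
      moreover from this have "\<alpha> \<preceq> \<beta>'" using fus by (auto simp: comp_le_def)
      ultimately show ?thesis by blast
    qed
  qed
next
  fix \<gamma> assume "\<gamma> \<in> ?S"
  moreover have "\<alpha> @ [y] \<preceq> fuse \<beta> y" if "\<alpha> \<preceq> \<beta>" for \<beta>
    using comp_le_snoc[OF that, of y] merge_step_fuse[OF comp_le_attachable[OF that assms]]
    by (auto simp: comp_le_def)
  ultimately show "\<gamma> \<in> {\<gamma>. \<alpha> @ [y] \<preceq> \<gamma>}"
    using comp_le_snoc by auto
qed

lemma fuse_inject: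
  assumes "attachable \<beta> y" "attachable \<beta>' y" "fuse \<beta> y = fuse \<beta>' y"
  shows "\<beta> = \<beta>'"
  using assms by (cases \<beta> rule: rev_exhaust; cases \<beta>' rule: rev_exhaust)
    (auto simp: attachable_def entry_eq_iff)

text \<open>
  Fusing changes the last entry: \<open>x \<oplus> y = y\<close> forces \<open>x\<close> to be the dotted \<open>0\<close> and \<open>y\<close> to be dotted,
  which \<open>attachable\<close> excludes.
\<close>

lemma snoc_neq_fuse:
  assumes "attachable \<beta>' y"
  shows "\<beta> @ [y] \<noteq> fuse \<beta>' y"
proof
  assume "\<beta> @ [y] = fuse \<beta>' y"
  moreover obtain us x where "\<beta>' = us @ [x]" "\<not> (is_dotted x \<and> is_dotted y)"
    using assms by (cases \<beta>' rule: rev_exhaust) (auto simp: attachable_def)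
  ultimately show False
    using entry_value_pos[of x] by (auto simp: entry_eq_iff)
qed

section \<open>Ribbons\<close>

lemma Hcomp_eq_sum_R: "Hcomp \<alpha> = (\<Sum>\<beta> | \<alpha> \<preceq> \<beta>. R \<beta>)"
proof -
  have "{\<beta>. \<alpha> \<preceq> \<beta>} = insert \<alpha> {\<beta>. \<alpha> \<prec> \<beta>}"
    by (auto simp: comp_less_def comp_le_def)
  moreover have "\<alpha> \<notin> {\<beta>. \<alpha> \<prec> \<beta>}"
    by (simp add: comp_less_def)
  ultimately show ?thesis
    by (simp add: finite_comp_less R.simps[of \<alpha>])
qed

text \<open>
  Expand the product of \<open>Hcomp \<alpha>\<close> and the generator in two ways: as the sum of the \<open>R \<beta> * generator y\<close>
  over all coarsenings \<open>\<beta>\<close> of \<open>\<alpha>\<close>, and, by \<open>coarsenings_snoc\<close>, as the sum of the claimed values of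
  these products.  By induction on the length the two expansions agree term by term for \<open>\<beta> \<noteq> \<alpha>\<close>,
  hence also for \<open>\<beta> = \<alpha>\<close>.
\<close>

lemma R_mult_generator:
  "attachable \<alpha> y \<Longrightarrow> R \<alpha> * generator y = R (\<alpha> @ [y]) + R (fuse \<alpha> y)"
proof (induction "length \<alpha>" arbitrary: \<alpha> rule: less_induct)
  case less
  let ?d = "\<lambda>\<beta>. R (\<beta> @ [y]) + R (fuse \<beta> y) - R \<beta> * generator y"
  have att: "attachable \<beta> y" if "\<alpha> \<preceq> \<beta>" for \<beta>
    using that less.prems by (rule comp_le_attachable)
  have "Hcomp \<alpha> * generator y = Hcomp (\<alpha> @ [y])"
    by (simp add: Hcomp_def)
  also have "\<dots> = (\<Sum>\<beta> | \<alpha> \<preceq> \<beta>. R (\<beta> @ [y])) + (\<Sum>\<beta> | \<alpha> \<preceq> \<beta>. R (fuse \<beta> y))"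
    unfolding Hcomp_eq_sum_R[of "\<alpha> @ [y]"] coarsenings_snoc[OF less.prems]
  proof (subst sum.union_disjoint)
    show "(\<lambda>\<beta>. \<beta> @ [y]) ` {\<beta>. \<alpha> \<preceq> \<beta>} \<inter> (\<lambda>\<beta>. fuse \<beta> y) ` {\<beta>. \<alpha> \<preceq> \<beta>} = {}"
      using snoc_neq_fuse att by blast
    have "inj_on (\<lambda>\<beta>. fuse \<beta> y) {\<beta>. \<alpha> \<preceq> \<beta>}"
      using fuse_inject att by (blast intro: inj_onI)
    moreover have "inj_on (\<lambda>\<beta>. \<beta> @ [y]) {\<beta>. \<alpha> \<preceq> \<beta>}"
      by (simp add: inj_on_def)
    ultimately show "sum R ((\<lambda>\<beta>. \<beta> @ [y]) ` {\<beta>. \<alpha> \<preceq> \<beta>}) + sum R ((\<lambda>\<beta>. fuse \<beta> y) ` {\<beta>. \<alpha> \<preceq> \<beta>})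
        = (\<Sum>\<beta> | \<alpha> \<preceq> \<beta>. R (\<beta> @ [y])) + (\<Sum>\<beta> | \<alpha> \<preceq> \<beta>. R (fuse \<beta> y))"
      by (simp add: sum.reindex)
  qed (simp_all add: finite_comp_le)
  finally have "(\<Sum>\<beta> | \<alpha> \<preceq> \<beta>. ?d \<beta>) = 0"
    by (simp add: Hcomp_eq_sum_R sum_distrib_right sum_subtractf sum.distrib)
  moreover have "(\<Sum>\<beta> | \<alpha> \<preceq> \<beta>. ?d \<beta>) = (\<Sum>\<beta>\<in>{\<alpha>}. ?d \<beta>)"
  proof (rule sum.mono_neutral_right)
    show "{\<alpha>} \<subseteq> {\<beta>. \<alpha> \<preceq> \<beta>}" by (simp add: comp_le_def)
    have "?d \<beta> = 0" if "\<alpha> \<preceq> \<beta>" "\<beta> \<noteq> \<alpha>" for \<beta>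
      using less.hyps[of \<beta>] comp_le_length[OF that(1)] that(2) att[OF that(1)] by auto
    then show "\<forall>\<beta>\<in>{\<beta>. \<alpha> \<preceq> \<beta>} - {\<alpha>}. ?d \<beta> = 0" by blast
  qed (rule finite_comp_le)
  ultimately show ?case by simp
qed

lemma R_Nil [simp]: "R [] = 1"
proof -
  have "{\<beta>. [] \<prec> \<beta>} = {}"
    using comp_less_length by fastforce
  then show ?thesis
    unfolding R.simps[of "[]"] by (simp only: sum.empty) (simp add: Hcomp_def)
qed

lemma R_singleton [simp]: "R [x] = generator x"
proof -
  have "\<not> [x] \<prec> \<beta>" for \<beta>
  proof
    assume "[x] \<prec> \<beta>"
    then have "merge_step\<^sup>*\<^sup>* [x] \<beta>" "[x] \<noteq> \<beta>"
      by (auto simp: comp_less_def comp_le_def)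
    then show False
      by (cases rule: converse_rtranclpE) (auto elim!: merge_step.cases simp: Cons_eq_append_conv)
  qed
  then have "{\<beta>. [x] \<prec> \<beta>} = {}" by simp
  then show ?thesis
    unfolding R.simps[of "[x]"] by (simp only: sum.empty) (simp add: Hcomp_def)
qed

section \<open>Columns and hooks\<close>

abbreviation ones :: "nat \<Rightarrow> dotted_composition"
  where "ones k \<equiv> replicate k (undotted 1)"

lemma ones_snoc: "ones (Suc k) = ones k @ [undotted 1]"
  by (simp add: replicate_append_same)

lemma ones_snoc_append: "ones (Suc k) @ w = ones k @ undotted 1 # w"
  unfolding ones_snoc by simp

lemma one_add_Dotted: "undotted 1 \<oplus> Dotted m = Dotted (Suc m)"
  and Dotted_add_undotted: "m \<ge> 1 \<Longrightarrow> Dotted l \<oplus> undotted m = Dotted (l + m)"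
  and one_add_undotted: "m \<ge> 1 \<Longrightarrow> undotted 1 \<oplus> undotted m = undotted (Suc m)"
  by (simp_all add: entry_eq_iff)

lemma H_pos: "m \<ge> 1 \<Longrightarrow> H m = generator (undotted m)"
  by (simp add: H_def)

lemma H_0: "H 0 = 1"
  by (simp add: H_def)

lemma R_ones_mult_generator:
  "R (ones (Suc k)) * generator y = R (ones (Suc k) @ [y]) + R (ones k @ [undotted 1 \<oplus> y])"
proof -
  have "attachable (ones (Suc k)) y"
    by (simp add: attachable_def)
  from R_mult_generator[OF this] show ?thesis
    unfolding ones_snoc by simp
qed

lemma R_snoc_mult_H:
  assumes "m \<ge> 1"
  shows "R (us @ [x]) * H m = R (us @ [x, undotted m]) + R (us @ [x \<oplus> undotted m])"
proof -
  have "attachable (us @ [x]) (undotted m)"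
    by (simp add: attachable_def)
  from R_mult_generator[OF this] show ?thesis
    using assms by (simp add: H_pos)
qed

text \<open>
  The value \<open>f (k - 1)\<close> with the convention \<open>f (-1) = 0\<close>, which makes the telescoping relations
  uniform in \<open>k\<close>.
\<close>

definition pred_term :: "(nat \<Rightarrow> 'a::zero) \<Rightarrow> nat \<Rightarrow> 'a"
  where "pred_term f k = (case k of 0 \<Rightarrow> 0 | Suc j \<Rightarrow> f j)"

lemma pred_term_simps [simp]: "pred_term f 0 = 0" "pred_term f (Suc j) = f j"
  by (simp_all add: pred_term_def)

text \<open>
  The hook ribbons of total weight \<open>n\<close>.  The value \<open>0\<close> at \<open>k = n\<close> lets \<open>R_ones_mult_H\<close> hold there too,
  because \<open>H 0 = 1\<close> and the column \<open>1\<^sup>n\<close> is itself the hook with \<open>k = n - 1\<close>.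
\<close>

definition hook :: "nat \<Rightarrow> nat \<Rightarrow> sNSym"
  where "hook n k = (if k < n then R (ones k @ [undotted (n - k)]) else 0)"

lemma R_ones_mult_H:
  assumes "n \<ge> 1" "k \<le> n"
  shows "R (ones k) * H (n - k) = hook n k + pred_term (hook n) k"
proof (cases k)
  case 0
  then show ?thesis using assms by (simp add: hook_def H_pos)
next
  case (Suc j)
  show ?thesis
  proof (cases "k = n")
    case True
    with Suc have "n = Suc j" by simp
    then show ?thesis
      using Suc ones_snoc[of j] by (simp add: hook_def H_0 One_nat_def del: replicate_Suc)
  next
    case False
    then have "undotted 1 \<oplus> undotted (n - k) = undotted (n - j)"
      using assms Suc by (simp add: one_add_undotted Suc_diff_Suc)
    then show ?thesis
      using False assms Suc R_ones_mult_generator[of j "undotted (n - k)"]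
      by (simp add: hook_def H_pos)
  qed
qed

lemma R_ones_mult_Ht:
  assumes "k \<le> n"
  shows "R (ones k) * Ht (n - k)
    = R (ones k @ [Dotted (n - k)]) + pred_term (\<lambda>j. R (ones j @ [Dotted (n - j)])) k"
proof (cases k)
  case 0
  then show ?thesis by (simp add: Ht_def)
next
  case (Suc j)
  then have "undotted 1 \<oplus> Dotted (n - k) = Dotted (n - j)"
    using assms by (simp add: one_add_Dotted Suc_diff_Suc)
  then show ?thesis
    using R_ones_mult_generator[of j "Dotted (n - k)"] Suc by (simp add: Ht_def)
qed

text \<open>
  All ways to introduce a dot into the column \<open>1\<^sup>k\<close>, by dotting an entry or by inserting a dotted \<open>0\<close>.
  The unchanged tail \<open>w\<close> makes a recursion on \<open>k\<close> possible; the tails \<open>[]\<close> and \<open>[undotted m]\<close>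
  give the coefficients of the inverse series and the summands of the final formula.
\<close>

definition dotted_ones :: "nat \<Rightarrow> dotted_composition \<Rightarrow> sNSym"
  where "dotted_ones k w = (\<Sum>i<k. R (ones i @ [Dotted 1] @ ones (k - Suc i) @ w))
    + (\<Sum>i\<le>k. R (ones i @ [Dotted 0] @ ones (k - i) @ w))"

lemma dotted_ones_0 [simp]: "dotted_ones 0 w = R (Dotted 0 # w)"
  by (simp add: dotted_ones_def)

text \<open>
  The dot lies either before the last \<open>1\<close> of the column, which can then be counted as part of
  the tail, or on this last \<open>1\<close>, or after it.
\<close>

lemma dotted_ones_Suc:
  "dotted_ones (Suc k) w = dotted_ones k (undotted 1 # w)
    + (R (ones k @ Dotted 1 # w) + R (ones (Suc k) @ Dotted 0 # w))"
proof -
  have "(\<Sum>i<k. R (ones i @ [Dotted 1] @ ones (Suc k - Suc i) @ w))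
      = (\<Sum>i<k. R (ones i @ [Dotted 1] @ ones (k - Suc i) @ undotted 1 # w))"
    by (intro sum.cong refl) (simp add: ones_snoc_append[symmetric] Suc_diff_Suc del: replicate_Suc)
  moreover have "(\<Sum>i\<le>k. R (ones i @ [Dotted 0] @ ones (Suc k - i) @ w))
      = (\<Sum>i\<le>k. R (ones i @ [Dotted 0] @ ones (k - i) @ undotted 1 # w))"
    by (intro sum.cong refl) (simp add: ones_snoc_append[symmetric] Suc_diff_le del: replicate_Suc)
  ultimately show ?thesis
    by (simp add: dotted_ones_def del: replicate_Suc)
qed

lemma dotted_ones_snoc_mult_H:
  assumes "m \<ge> 1"
  shows "dotted_ones k (w @ [x]) * H m
    = dotted_ones k (w @ [x, undotted m]) + dotted_ones k (w @ [x \<oplus> undotted m])"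
proof -
  have "R (us @ v @ us' @ w @ [x]) * H m
      = R (us @ v @ us' @ w @ [x, undotted m]) + R (us @ v @ us' @ w @ [x \<oplus> undotted m])"
    for us v us'
    using R_snoc_mult_H[OF assms, of "us @ v @ us' @ w" x] by simp
  then show ?thesis
    unfolding dotted_ones_def distrib_right sum_distrib_right by (simp only: sum.distrib add_ac)
qed

definition dotted_hook :: "nat \<Rightarrow> nat \<Rightarrow> sNSym"
  where "dotted_hook n k = (if k < n then dotted_ones k [undotted (n - k)] else 0)"

text \<open>
  Appending the new entry gives \<open>dotted_hook n k\<close>.  Fusing it with a last entry \<open>1\<close> gives
  \<open>dotted_hook n (k - 1)\<close>.  If the dot is in the last entry, fusing produces a column ending in one
  large dotted entry; the ribbons of this kind add up to \<open>R (ones k) * Ht (n - k)\<close>.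
\<close>

lemma dotted_ones_mult_H:
  assumes "k \<le> n"
  shows "dotted_ones k [] * H (n - k)
    = dotted_hook n k + pred_term (dotted_hook n) k + R (ones k) * Ht (n - k)"
proof (cases "k = n")
  case True
  show ?thesis
  proof (cases k)
    case 0
    then show ?thesis using True by (simp add: H_0 dotted_hook_def Ht_def)
  next
    case (Suc j)
    with True have "n = Suc j" by simp
    with Suc R_ones_mult_Ht[OF assms] show ?thesis
      by (simp add: H_0 dotted_hook_def dotted_ones_Suc One_nat_def del: replicate_Suc)
  qed
next
  case False
  then have m: "n - k \<ge> 1" using assms by simp
  show ?thesis
  proof (cases k)
    case 0
    then show ?thesis
      using R_snoc_mult_H[OF m, of "[]" "Dotted 0"] m
      by (simp add: dotted_hook_def Ht_def Dotted_add_undotted)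
  next
    case (Suc j)
    have "undotted 1 \<oplus> undotted (n - k) = undotted (n - j)"
      "Dotted 1 \<oplus> undotted (n - k) = Dotted (n - j)"
      "Dotted 0 \<oplus> undotted (n - k) = Dotted (n - k)"
      using m Suc by (simp_all add: one_add_undotted Dotted_add_undotted Suc_diff_Suc)
    moreover have "Suc j < n" using m Suc by linarith
    ultimately show ?thesis
      using dotted_ones_snoc_mult_H[OF m, of j "[]" "undotted 1"] m Suc
        R_snoc_mult_H[OF m, of "ones j" "Dotted 1"] R_snoc_mult_H[OF m, of "ones k" "Dotted 0"]
        R_ones_mult_Ht[OF assms]
      by (simp add: dotted_hook_def dotted_ones_Suc distrib_right del: replicate_Suc)
  qed
qed

section \<open>Alternating sums\<close>

lemma alternating_telescope:
  fixes f :: "nat \<Rightarrow> 'a::ring_1"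
  shows "(\<Sum>k\<le>j. (- 1) ^ k * (f k + pred_term f k)) = (- 1) ^ j * f j"
  by (induction j) (simp_all add: algebra_simps)

text \<open>
  Each \<open>f k\<close> with \<open>k < j\<close> occurs with weight \<open>n - k\<close> and then, as predecessor, with weight \<open>n - k - 1\<close>
  and the opposite sign.
\<close>

lemma weighted_alternating_telescope:
  fixes f :: "nat \<Rightarrow> 'a::ring_1"
  assumes "j \<le> n"
  shows "(\<Sum>k\<le>j. (- 1) ^ k * (of_nat (n - k) * (f k + pred_term f k)))
    = (\<Sum>k<j. (- 1) ^ k * f k) + (- 1) ^ j * (of_nat (n - j) * f j)"
  using assms
proof (induction j)
  case 0
  then show ?case by simp
next
  case (Suc j)
  then have "n - j = Suc (n - Suc j)" by simp
  with Suc show ?case by (simp add: algebra_simps)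
qed

section \<open>The inverse of the generating function\<close>

unbundle fps_syntax

text \<open>
  The parts of \<open>\<lambda>\<^sup>-\<^sup>1\<close> of degree \<open>0\<close> and \<open>1\<close> in \<open>\<tau>\<close>.  Formal power series over a noncommutative ring have
  a central variable, as required here; \<open>\<tau>\<close> is handled by treating the two parts separately.
\<close>

definition inv_even :: "sNSym fps"
  where "inv_even = Abs_fps (\<lambda>k. (- 1) ^ k * R (ones k))"

definition inv_odd :: "sNSym fps"
  where "inv_odd = Abs_fps (\<lambda>k. - ((- 1) ^ k * dotted_ones k []))"

lemma inv_even_mult_H: "inv_even * Abs_fps H = 1"
proof (rule fps_ext)
  fix n
  show "(inv_even * Abs_fps H) $ n = 1 $ n"
  proof (cases "n = 0")
    case True
    then show ?thesis by (simp add: fps_mult_nth inv_even_def H_0)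
  next
    case False
    then have "(inv_even * Abs_fps H) $ n = (\<Sum>k\<le>n. (- 1) ^ k * (hook n k + pred_term (hook n) k))"
      unfolding fps_mult_nth atLeast0AtMost
      by (intro sum.cong refl) (simp add: inv_even_def R_ones_mult_H mult.assoc)
    also have "\<dots> = 0"
      unfolding alternating_telescope by (simp add: hook_def)
    finally show ?thesis using False by simp
  qed
qed

lemma inv_odd_mult_H: "inv_odd * Abs_fps H + inv_even * Abs_fps Ht = 0"
proof (rule fps_ext)
  fix n
  have "(inv_odd * Abs_fps H + inv_even * Abs_fps Ht) $ n
      = (\<Sum>k\<le>n. - ((- 1) ^ k * (dotted_hook n k + pred_term (dotted_hook n) k)))"
    unfolding fps_mult_nth fps_add_nth sum.distrib[symmetric] atLeast0AtMost
    by (intro sum.cong refl)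
      (simp add: inv_even_def inv_odd_def dotted_ones_mult_H mult.assoc distrib_left)
  also have "\<dots> = 0"
    unfolding sum_negf alternating_telescope by (simp add: dotted_hook_def)
  finally show "(inv_odd * Abs_fps H + inv_even * Abs_fps Ht) $ n = 0 $ n" by simp
qed

text \<open>
  Multiply the \<open>\<tau>\<close>-part of \<open>\<lambda> \<Pi> = (t \<partial>\<^sub>t + \<tau> \<partial>\<^sub>\<tau>) \<lambda>\<close> by \<open>inv_even\<close> from the left, and use
  \<open>inv_odd_mult_H\<close> to bring the \<open>\<tau>\<close>-free part into play and eliminate the even power sums.
\<close>

lemma odd_power_sum_series:
  "Abs_fps (\<lambda>n. of_nat (n + 1) * Pt n)
    = inv_even * Abs_fps (\<lambda>n. of_nat (n + 1) * Ht n) + inv_odd * Abs_fps (\<lambda>n. of_nat n * H n)"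
proof -
  let ?h = "Abs_fps H" and ?ht = "Abs_fps Ht" and ?p = "Abs_fps P"
    and ?q = "Abs_fps (\<lambda>n. of_nat (n + 1) * Pt n)"
  have hp: "?h * ?p = Abs_fps (\<lambda>n. of_nat n * H n)"
  proof (rule fps_ext)
    fix n
    have "(\<Sum>k\<le>n. H k * P (n - k)) = of_nat n * H n"
      using H_P[of n] by (cases "n = 0") (simp_all add: P_0 lessThan_Suc_atMost[symmetric])
    then show "(?h * ?p) $ n = Abs_fps (\<lambda>n. of_nat n * H n) $ n"
      by (simp add: fps_mult_nth atLeast0AtMost)
  qed
  have swap: "x * (of_nat m * y) = of_nat m * (x * y)" for x y :: sNSym and m
    by (metis mult.assoc mult_of_nat_commute)
  have hq: "?ht * ?p + ?h * ?q = Abs_fps (\<lambda>n. of_nat (n + 1) * Ht n)"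
  proof (rule fps_ext)
    fix n
    have "(\<Sum>k\<le>n. Ht k * P (n - k)) = (\<Sum>k\<le>n. Ht (n - k) * P k)"
      using sum.atLeastAtMost_rev[of "\<lambda>k. Ht k * P (n - k)" 0 n] by (simp add: atLeast0AtMost)
    moreover have "(\<Sum>k\<le>n. H k * (of_nat (n - k + 1) * Pt (n - k)))
        = (\<Sum>k\<le>n. of_nat (k + 1) * (H (n - k) * Pt k))"
      using sum.atLeastAtMost_rev[of "\<lambda>k. H k * (of_nat (n - k + 1) * Pt (n - k))" 0 n]
      by (simp add: atLeast0AtMost swap del: of_nat_Suc of_nat_add)
    ultimately show "(?ht * ?p + ?h * ?q) $ n = Abs_fps (\<lambda>n. of_nat (n + 1) * Ht n) $ n"
      using Ht_P_H_Pt[of n]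
      by (simp add: fps_mult_nth atLeast0AtMost sum.distrib del: of_nat_Suc of_nat_add)
  qed
  have "?q = inv_even * ?h * ?q"
    by (simp add: inv_even_mult_H)
  also have "\<dots> = inv_even * (?ht * ?p + ?h * ?q) - inv_even * ?ht * ?p"
    by (simp add: algebra_simps)
  also have "inv_even * ?ht = - (inv_odd * ?h)"
    using inv_odd_mult_H by (simp add: eq_neg_iff_add_eq_0 add.commute)
  finally show ?thesis
    unfolding hq by (simp add: mult.assoc hp)
qed

section \<open>The ribbon expansion of the dotted power sums\<close>

theorem proposition6p8:
  fixes n :: nat
  assumes "n \<ge> 1"
  shows "of_nat (n + 1) * Pt n =
    - R [Dotted 0, undotted n]
    + (- 1) ^ n * R (replicate n (undotted 1) @ [Dotted 0])
    + (\<Sum>k = 1..n - 1. (- 1) ^ (k + 1) *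
        ((\<Sum>i = 1..k. R (replicate (i - 1) (undotted 1) @ [Dotted 1]
              @ replicate (k - i) (undotted 1) @ [undotted (n - k)]))
         + (\<Sum>i = 0..k. R (replicate i (undotted 1) @ [Dotted 0]
              @ replicate (k - i) (undotted 1) @ [undotted (n - k)]))))"
proof -
  let ?u = "\<lambda>k. R (ones k) * Ht (n - k)"
  let ?g = "\<lambda>k. dotted_hook n k + pred_term (dotted_hook n) k"
  have "of_nat (n + 1) * Pt n
      = (\<Sum>k\<le>n. (- 1) ^ k * R (ones k) * (of_nat (n - k + 1) * Ht (n - k))
          - (- 1) ^ k * dotted_ones k [] * (of_nat (n - k) * H (n - k)))"
    using arg_cong[OF odd_power_sum_series, of "\<lambda>s. s $ n"]
    by (simp add: fps_mult_nth inv_even_def inv_odd_def atLeast0AtMost sum_negf sum_subtractf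
        del: of_nat_Suc of_nat_add of_nat_diff)
  \<comment> \<open>The products \<open>?u k\<close> occur with weights \<open>n - k + 1\<close> and \<open>n - k\<close>, so their net weight is \<open>1\<close>.\<close>
  also have "\<dots> = (\<Sum>k\<le>n. (- 1) ^ k * ?u k - (- 1) ^ k * (of_nat (n - k) * ?g k))"
  proof (intro sum.cong refl)
    fix k assume "k \<in> {..n}"
    then have "dotted_ones k [] * H (n - k) = ?g k + ?u k"
      by (simp add: dotted_ones_mult_H)
    moreover have "a * b * (of_nat m * c) = a * (of_nat m * (b * c))" for a b c :: sNSym and m
      by (metis mult.assoc mult_of_nat_commute)
    ultimately show "(- 1) ^ k * R (ones k) * (of_nat (n - k + 1) * Ht (n - k))
          - (- 1) ^ k * dotted_ones k [] * (of_nat (n - k) * H (n - k))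
        = (- 1) ^ k * ?u k - (- 1) ^ k * (of_nat (n - k) * ?g k)"
      by (simp add: algebra_simps)
  qed
  also have "\<dots> = (- 1) ^ n * R (ones n @ [Dotted 0]) - (\<Sum>k<n. (- 1) ^ k * dotted_hook n k)"
  proof -
    have "(\<Sum>k\<le>n. (- 1) ^ k * ?u k)
        = (\<Sum>k\<le>n. (- 1) ^ k * (R (ones k @ [Dotted (n - k)])
            + pred_term (\<lambda>j. R (ones j @ [Dotted (n - j)])) k))"
      by (intro sum.cong refl) (simp add: R_ones_mult_Ht)
    then show ?thesis
      unfolding sum_subtractf alternating_telescope weighted_alternating_telescope[OF order_refl]
      by simp
  qed
  also have "(\<Sum>k<n. (- 1) ^ k * dotted_hook n k)
      = R [Dotted 0, undotted n] + (\<Sum>k = 1..n - 1. (- 1) ^ k * dotted_hook n k)"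
  proof -
    have "{..<n} = insert 0 {1..n - 1}" using assms by auto
    then show ?thesis using assms by (simp add: dotted_hook_def)
  qed
  also have "(\<Sum>k = 1..n - 1. (- 1) ^ k * dotted_hook n k)
      = - (\<Sum>k = 1..n - 1. (- 1) ^ (k + 1) *
        ((\<Sum>i = 1..k. R (ones (i - 1) @ [Dotted 1] @ ones (k - i) @ [undotted (n - k)]))
         + (\<Sum>i = 0..k. R (ones i @ [Dotted 0] @ ones (k - i) @ [undotted (n - k)]))))"
    unfolding sum_negf[symmetric]
  proof (intro sum.cong refl)
    fix k assume "k \<in> {1..n - 1}"
    then have "k < n" using assms by auto
    have "(\<Sum>i = 1..k. R (ones (i - 1) @ [Dotted 1] @ ones (k - i) @ [undotted (n - k)]))
        = (\<Sum>i<k. R (ones i @ [Dotted 1] @ ones (k - Suc i) @ [undotted (n - k)]))"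
      by (simp add: One_nat_def sum.atLeast1_atMost_eq)
    then show "(- 1) ^ k * dotted_hook n k = - ((- 1) ^ (k + 1) *
        ((\<Sum>i = 1..k. R (ones (i - 1) @ [Dotted 1] @ ones (k - i) @ [undotted (n - k)]))
         + (\<Sum>i = 0..k. R (ones i @ [Dotted 0] @ ones (k - i) @ [undotted (n - k)]))))"
      using \<open>k < n\<close> by (simp add: dotted_hook_def dotted_ones_def atLeast0AtMost power_add)
  qed
  finally show ?thesis
    by simp
qed

end
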